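(* For every $x \in (0,\pi/2)$ one has $\Phi_1(x) < \Psi_1(x)$. Consequently, for every $x\in(0,\pi/2)$, $$\frac{2 + \cos x}{3} - \left(\frac{2}{3} - \frac{2}{\pi}\right)\Psi_1(x) < \frac{2 + \cos x}{3} - \left(\frac{2}{3} - \frac{2}{\pi}\right)\Phi_1(x)$$ and $$\frac{2 + \cos x}{3} - \left(\frac{2}{3} - \frac{2}{\pi}\right)\Psi_2(x) < \frac{2 + \cos x}{3} - \left(\frac{2}{3} - \frac{2}{\pi}\right)\Phi_2(x),$$ and $$\frac{2 + \cos x}{3} - \left(\frac{2}{3} - \frac{2}{\pi}\right)\Phi_1(x) < \frac{\sin x}{x} < \frac{2 + \cos x}{3} - \left(\frac{2}{3} - \frac{2}{\pi}\right)\Psi_2(x).$$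
   Context: For real $x$, define $\Phi_1(x) := (\pi/2-1)^{-1}(x-\sin x)$, $\Phi_2(x) := (\pi/2-1)^{-2}(x-\sin x)^2$, $\Psi_1(x) := \sin x - x \cos x$ and $\Psi_2(x) := (\sin x - x \cos x)^2$. *)

theory Defs
  imports Complex_Main
begin

definition Phi1 :: "real \<Rightarrow> real" (\<open>\<Phi>\<^sub>1\<close>)
  where "\<Phi>\<^sub>1 x = (pi / 2 - 1) powi (-1) * (x - sin x)"

definition Phi2 :: "real \<Rightarrow> real" (\<open>\<Phi>\<^sub>2\<close>)
  where "\<Phi>\<^sub>2 x = (pi / 2 - 1) powi (-2) * (x - sin x)\<^sup>2"

definition Psi1 :: "real \<Rightarrow> real" (\<open>\<Psi>\<^sub>1\<close>)
  where "\<Psi>\<^sub>1 x = sin x - x * cos x"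

definition Psi2 :: "real \<Rightarrow> real" (\<open>\<Psi>\<^sub>2\<close>)
  where "\<Psi>\<^sub>2 x = (sin x - x * cos x)\<^sup>2"

end

theory Submission
  imports Defs "HOL-Analysis.Complex_Transcendental"
begin

text \<open>
  All the inequalities come from three estimates on \<open>(0, pi / 2)\<close>, each saying that some smooth
  \<open>f\<close> is positive there, although \<open>f\<close> vanishes at both ends of the interval: for the bounds of
  \<open>sin x / x\<close> the constant \<open>2 / 3 - 2 / pi\<close> is exactly what makes both bounds sharp at \<open>pi / 2\<close>,
  and \<open>pi / 2 - 1\<close> normalises \<open>\<Phi>\<^sub>1 (pi / 2) = \<Psi>\<^sub>1 (pi / 2) = 1\<close>. Hence \<open>f\<close> itself is not
  monotone, and its shape has to be controlled instead.

  The shape used is that \<open>f\<close>, once nonpositive, is negative ever after (\<open>downcrossing\<close>). A function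
  of this shape with a zero at the right end is positive before it. The shape is inherited by the
  antiderivative that vanishes at \<open>0\<close> (\<open>downcrossing_antiderivative\<close>), because starting from \<open>0\<close>
  it can only be nonpositive at a point where it is already decreasing for good. Each of the three
  functions \<open>f\<close> vanishes at \<open>0\<close> together with its first and second derivatives, so it is enough to
  check the shape of its second or third derivative. There it holds since, after division by a
  positive function, what is left is strictly decreasing (\<open>downcrossing_if_decreasing_quotient\<close>).
  In effect this is the monotone form of l'Hopital's rule.

  The three instances are \<open>x_minus_sin_less\<close>, which is \<open>\<Phi>\<^sub>1 < \<Psi>\<^sub>1\<close>, and
  \<open>cusa_defect_upper\<close> and \<open>cusa_defect_lower\<close>, which bound
  \<open>x * (2 + cos x) - 3 * sin x\<close>, the gap in the Cusa-Huygens inequality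
  \<open>sin x / x < (2 + cos x) / 3\<close> multiplied by \<open>3 * x\<close>. The comparison of \<open>\<Psi>\<^sub>2\<close> with \<open>\<Phi>\<^sub>2\<close>
  follows from that of \<open>\<Psi>\<^sub>1\<close> with \<open>\<Phi>\<^sub>1\<close> by squaring, and \<open>pi > 3\<close> makes
  \<open>2 / 3 - 2 / pi\<close> positive.
\<close>

section \<open>Functions with a single downward sign change\<close>

definition downcrossing :: "real \<Rightarrow> (real \<Rightarrow> real) \<Rightarrow> bool"
  where "downcrossing b f \<longleftrightarrow> (\<forall>x y. 0 < x \<longrightarrow> x < y \<longrightarrow> y \<le> b \<longrightarrow> f x \<le> 0 \<longrightarrow> f y < 0)"

lemma downcrossingD:
  "downcrossing b f \<Longrightarrow> 0 < x \<Longrightarrow> x < y \<Longrightarrow> y \<le> b \<Longrightarrow> f x \<le> 0 \<Longrightarrow> f y < 0"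
  unfolding downcrossing_def by blast

text \<open>If \<open>f\<close> has come back to a value \<open>f x \<le> 0 = f 0\<close>, then by the mean value theorem \<open>f'\<close> was
  already nonpositive somewhere before \<open>x\<close>; hence \<open>f'\<close> is negative from \<open>x\<close> on, and \<open>f\<close>
  decreases strictly.\<close>

lemma downcrossing_antiderivative:
  assumes deriv: "\<And>x. (f has_real_derivative f' x) (at x)"
    and zero: "f 0 = 0"
    and f': "downcrossing b f'"
  shows "downcrossing b f"
  unfolding downcrossing_def
proof (intro allI impI)
  fix x y :: real
  assume xy: "0 < x" "x < y" "y \<le> b" and fx: "f x \<le> 0"
  obtain z where z: "0 < z" "z < x" "f x - f 0 = (x - 0) * f' z"
    using MVT2[of 0 x f f'] deriv xy(1) by blast
  have "f' z \<le> 0"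
    using z fx zero xy(1) by (simp add: mult_le_0_iff)
  then have neg: "f' w < 0" if "x \<le> w" "w \<le> y" for w
    using downcrossingD[OF f', of z w] z that xy by simp
  have "f y < f x"
    using DERIV_neg_imp_decreasing[of x y f] deriv neg xy(2) by blast
  then show "f y < 0" using fx by simp
qed

lemma downcrossing_pos:
  assumes "downcrossing b f" "f b = 0" "0 < x" "x < b"
  shows "0 < f x"
  using downcrossingD[OF assms(1), of x b] assms(2-4) by force

lemma downcrossing_if_decreasing_quotient:
  assumes decr: "\<And>x y. 0 < x \<Longrightarrow> x < y \<Longrightarrow> y \<le> b \<Longrightarrow> r y < r x"
    and pos: "\<And>x. 0 < x \<Longrightarrow> x \<le> b \<Longrightarrow> 0 < w x"
    and eq: "\<And>x. 0 < x \<Longrightarrow> x \<le> b \<Longrightarrow> f x = w x * r x"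
  shows "downcrossing b f"
  unfolding downcrossing_def
proof (intro allI impI)
  fix x y :: real
  assume xy: "0 < x" "x < y" "y \<le> b" and "f x \<le> 0"
  then have "r x \<le> 0"
    using pos[of x] eq[of x] by (simp add: mult_le_0_iff)
  then have "r y < 0" using decr[of x y] xy by simp
  then show "f y < 0"
    using pos[of y] eq[of y] xy by (simp add: mult_pos_neg)
qed

section \<open>Monotonicity on the first quadrant\<close>

lemma sin_mono_quadrant: "0 \<le> x \<Longrightarrow> x \<le> y \<Longrightarrow> y \<le> pi / 2 \<Longrightarrow> sin x \<le> sin y"
  by (intro sin_monotone_2pi_le) auto

lemma cos_mono_quadrant: "0 \<le> x \<Longrightarrow> x \<le> y \<Longrightarrow> y \<le> pi / 2 \<Longrightarrow> cos y \<le> cos x"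
  by (intro cos_monotone_0_pi_le) auto

lemma sin_pos_quadrant: "0 < x \<Longrightarrow> x \<le> pi / 2 \<Longrightarrow> 0 < sin x"
  using pi_gt_zero by (intro sin_gt_zero) linarith+

lemma cos_nonneg_quadrant: "0 \<le> x \<Longrightarrow> x \<le> pi / 2 \<Longrightarrow> 0 \<le> cos x"
  by (intro cos_ge_zero) auto

text \<open>The function vanishes at \<open>0\<close> and its derivative is \<open>x * sin x\<close>.\<close>

lemma sin_minus_x_cos_pos:
  fixes x :: real
  assumes "0 < x" "x \<le> pi / 2"
  shows "0 < sin x - x * cos x"
proof -
  have "\<exists>d. ((\<lambda>t. sin t - t * cos t) has_real_derivative d) (at t) \<and> 0 < d"
    if "0 < t" "t < x" for t
    using sin_pos_quadrant[of t] that assms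
    by (intro exI[of _ "t * sin t"]) (auto intro!: derivative_eq_intros)
  moreover have "continuous_on {0..x} (\<lambda>t. sin t - t * cos t)"
    by (intro continuous_intros)
  ultimately have "(\<lambda>t. sin t - t * cos t) 0 < (\<lambda>t. sin t - t * cos t) x"
    using DERIV_pos_imp_increasing_open[of 0 x] assms(1) by blast
  then show ?thesis by simp
qed

text \<open>This is the sign condition for \<open>x ^ 3 / (sin x - x * cos x)\<close> to increase. The difference of the
  two sides vanishes at \<open>0\<close> and has the derivative \<open>x * (sin x - x * cos x)\<close>.\<close>

lemma x_sq_sin_less:
  fixes x :: real
  assumes "0 < x" "x \<le> pi / 2"
  shows "x\<^sup>2 * sin x < 3 * (sin x - x * cos x)"
proof -
  let ?g = "\<lambda>t. 3 * (sin t - t * cos t) - t\<^sup>2 * sin t"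
  have "\<exists>d. (?g has_real_derivative d) (at t) \<and> 0 < d" if "0 < t" "t < x" for t
    using sin_minus_x_cos_pos[of t] that assms
    by (intro exI[of _ "t * (sin t - t * cos t)"])
       (auto intro!: derivative_eq_intros simp: algebra_simps power2_eq_square)
  moreover have "continuous_on {0..x} ?g"
    by (intro continuous_intros)
  ultimately have "?g 0 < ?g x"
    using DERIV_pos_imp_increasing_open[of 0 x] assms(1) by blast
  then show ?thesis by simp
qed

lemma cube_over_sin_minus_x_cos_strict_mono:
  fixes x y :: real
  assumes "0 < x" "x < y" "y \<le> pi / 2"
  shows "x ^ 3 / (sin x - x * cos x) < y ^ 3 / (sin y - y * cos y)"
proof (rule DERIV_pos_imp_increasing[OF assms(2)])
  fix t assume t: "x \<le> t" "t \<le> y"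
  let ?u = "sin t - t * cos t"
  have u: "?u > 0" using sin_minus_x_cos_pos[of t] t assms by simp
  have "((\<lambda>t. t ^ 3 / (sin t - t * cos t)) has_real_derivative
      t\<^sup>2 * (3 * ?u - t\<^sup>2 * sin t) / ?u\<^sup>2) (at t)"
    using u by (auto intro!: derivative_eq_intros)
      (simp add: algebra_simps power2_eq_square power3_eq_cube)
  moreover have "0 < t\<^sup>2 * (3 * ?u - t\<^sup>2 * sin t) / ?u\<^sup>2"
    using u x_sq_sin_less[of t] t assms by (intro divide_pos_pos mult_pos_pos) auto
  ultimately show "\<exists>d. ((\<lambda>t. t ^ 3 / (sin t - t * cos t)) has_real_derivative d) (at t) \<and> 0 < d"
    by blast
qed

text \<open>Up to \<open>pi / 2\<close> the derivative \<open>2 * (3 - x\<^sup>2) * sin x + 10 * x * cos x\<close> is positive because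
  \<open>pi / 2 \<le> 1.6\<close>, which lies below \<open>sqrt 3\<close>.\<close>

lemma x_sin_plus_sq_cos_strict_mono:
  fixes x y :: real
  assumes "0 < x" "x < y" "y \<le> pi / 2"
  shows "6 * x * sin x + 2 * x\<^sup>2 * cos x < 6 * y * sin y + 2 * y\<^sup>2 * cos y"
proof (rule DERIV_pos_imp_increasing[OF assms(2)])
  fix t assume t: "x \<le> t" "t \<le> y"
  have "t \<le> 1.6" using t assms pi_approx by simp
  then have "t\<^sup>2 \<le> 1.6\<^sup>2" using t assms by (intro power_mono) auto
  then have "t\<^sup>2 < 3" by (simp add: power2_eq_square)
  then have "0 < 2 * sin t * (3 - t\<^sup>2) + 10 * (t * cos t)"
    using sin_pos_quadrant[of t] cos_nonneg_quadrant[of t] t assms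
    by (intro add_pos_nonneg mult_pos_pos mult_nonneg_nonneg) auto
  moreover have "((\<lambda>t. 6 * t * sin t + 2 * t\<^sup>2 * cos t) has_real_derivative
      2 * sin t * (3 - t\<^sup>2) + 10 * (t * cos t)) (at t)"
    by (auto intro!: derivative_eq_intros simp: algebra_simps power2_eq_square)
  ultimately show "\<exists>d. ((\<lambda>t. 6 * t * sin t + 2 * t\<^sup>2 * cos t) has_real_derivative d) (at t) \<and> 0 < d"
    by blast
qed

section \<open>The three estimates\<close>

text \<open>The third derivative of the difference of the sides is itself strictly decreasing, since
  \<open>pi / 2 - 1 > 1 / 2\<close>.\<close>

lemma x_minus_sin_less:
  fixes x :: real
  assumes "0 < x" "x < pi / 2"
  shows "x - sin x < (pi / 2 - 1) * (sin x - x * cos x)"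
proof -
  define m where "m = pi / 2 - 1"
  have m: "1 / 2 < m" using pi_approx by (simp add: m_def)
  let ?f = "\<lambda>t. m * (sin t - t * cos t) - (t - sin t)"
  let ?f1 = "\<lambda>t. m * (t * sin t) - (1 - cos t)"
  let ?f2 = "\<lambda>t. m * (sin t + t * cos t) - sin t"
  let ?f3 = "\<lambda>t. (2 * m - 1) * cos t - m * (t * sin t)"
  have "downcrossing (pi / 2) ?f3"
  proof (rule downcrossing_if_decreasing_quotient[where r = ?f3 and w = "\<lambda>_. 1"])
    fix s t :: real assume st: "0 < s" "s < t" "t \<le> pi / 2"
    have "(2 * m - 1) * cos t \<le> (2 * m - 1) * cos s"
      using cos_mono_quadrant[of s t] st m by (intro mult_left_mono) auto
    moreover have "s * sin s < t * sin t"
      using st sin_mono_quadrant[of s t] sin_pos_quadrant[of s]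
      by (intro mult_less_le_imp_less) auto
    then have "m * (s * sin s) < m * (t * sin t)" using m by simp
    ultimately show "?f3 t < ?f3 s" by linarith
  qed auto
  then have "downcrossing (pi / 2) ?f2"
    by (rule downcrossing_antiderivative[rotated 2])
       (auto intro!: derivative_eq_intros simp: algebra_simps)
  then have "downcrossing (pi / 2) ?f1"
    by (rule downcrossing_antiderivative[rotated 2])
       (auto intro!: derivative_eq_intros simp: algebra_simps)
  then have "downcrossing (pi / 2) ?f"
    by (rule downcrossing_antiderivative[rotated 2])
       (auto intro!: derivative_eq_intros simp: algebra_simps)
  moreover have "?f (pi / 2) = 0" by (simp add: m_def)
  ultimately have "0 < ?f x" using assms by (rule downcrossing_pos)
  then show ?thesis by (simp add: m_def)
qed

text \<open>With \<open>k = (2 - 6 / pi) / (pi / 2 - 1)\<close>, the value that gives equality at \<open>pi / 2\<close>, the third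
  derivative of the difference of the sides is \<open>x * sin x\<close> times \<open>k * (3 / x + cot x) - 1\<close>,
  which decreases.\<close>

lemma cusa_defect_upper:
  fixes x :: real
  assumes "0 < x" "x < pi / 2"
  shows "x * (2 + cos x) - 3 * sin x < (2 - 6 / pi) / (pi / 2 - 1) * (x * (x - sin x))"
proof -
  define k where "k = (2 - 6 / pi) / (pi / 2 - 1)"
  have k: "0 < k" using pi_approx by (simp add: k_def field_simps)
  let ?f = "\<lambda>t. k * (t * (t - sin t)) - (t * (2 + cos t) - 3 * sin t)"
  let ?f1 = "\<lambda>t. k * (2 * t - sin t - t * cos t) - (2 - 2 * cos t - t * sin t)"
  let ?f2 = "\<lambda>t. k * (2 - 2 * cos t + t * sin t) - (sin t - t * cos t)"
  let ?f3 = "\<lambda>t. k * (3 * sin t + t * cos t) - t * sin t"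
  have "downcrossing (pi / 2) ?f3"
  proof (rule downcrossing_if_decreasing_quotient
      [where r = "\<lambda>t. k * (3 / t + cos t / sin t) - 1" and w = "\<lambda>t. t * sin t"])
    fix s t :: real assume st: "0 < s" "s < t" "t \<le> pi / 2"
    have "3 / t < 3 / s" using st by (simp add: field_simps)
    moreover have "cos t / sin t \<le> cos s / sin s"
      using st cos_mono_quadrant[of s t] sin_mono_quadrant[of s t]
        sin_pos_quadrant[of s] cos_nonneg_quadrant[of s]
      by (intro frac_le) auto
    ultimately have "k * (3 / t + cos t / sin t) < k * (3 / s + cos s / sin s)"
      using k by simp
    then show "k * (3 / t + cos t / sin t) - 1 < k * (3 / s + cos s / sin s) - 1" by simp
  next
    fix t :: real assume t: "0 < t" "t \<le> pi / 2"
    then have "sin t > 0" by (rule sin_pos_quadrant)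
    with t show "0 < t * sin t" "?f3 t = t * sin t * (k * (3 / t + cos t / sin t) - 1)"
      by (simp_all add: field_simps)
  qed
  then have "downcrossing (pi / 2) ?f2"
    by (rule downcrossing_antiderivative[rotated 2])
       (auto intro!: derivative_eq_intros simp: algebra_simps)
  then have "downcrossing (pi / 2) ?f1"
    by (rule downcrossing_antiderivative[rotated 2])
       (auto intro!: derivative_eq_intros simp: algebra_simps)
  then have "downcrossing (pi / 2) ?f"
    by (rule downcrossing_antiderivative[rotated 2])
       (auto intro!: derivative_eq_intros simp: algebra_simps)
  moreover have "?f (pi / 2) = 0"
    using pi_approx by (simp add: k_def field_simps)
  ultimately have "0 < ?f x" using assms by (rule downcrossing_pos)
  then show ?thesis by (simp add: k_def)
qed

text \<open>Two differentiations suffice: with \<open>u = sin x - x * cos x\<close>, the second derivative of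
  \<open>x * (2 + cos x) - 3 * sin x\<close> is \<open>u\<close>, and since \<open>u\<close> has the derivative \<open>x * sin x\<close>, division
  by \<open>u\<close> turns the second derivative of \<open>x * u\<^sup>2\<close> into an expression in increasing functions. The
  constant \<open>2 - 6 / pi\<close> gives equality at \<open>pi / 2\<close>.\<close>

lemma cusa_defect_lower:
  fixes x :: real
  assumes "0 < x" "x < pi / 2"
  shows "(2 - 6 / pi) * (x * (sin x - x * cos x)\<^sup>2) < x * (2 + cos x) - 3 * sin x"
proof -
  define q where "q = 2 - 6 / pi"
  have q: "0 < q" using pi_approx by (simp add: q_def field_simps)
  let ?u = "\<lambda>t. sin t - t * cos t"
  let ?f = "\<lambda>t. t * (2 + cos t) - 3 * sin t - q * (t * (?u t)\<^sup>2)"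
  let ?f1 = "\<lambda>t. 2 - 2 * cos t - t * sin t - q * ((?u t)\<^sup>2 + 2 * t\<^sup>2 * sin t * ?u t)"
  let ?f2 = "\<lambda>t. ?u t - q * (6 * t * sin t * ?u t + 2 * t\<^sup>2 * cos t * ?u t + 2 * t ^ 3 * (sin t)\<^sup>2)"
  let ?r = "\<lambda>t. 1 - q * ((6 * t * sin t + 2 * t\<^sup>2 * cos t) + 2 * (sin t)\<^sup>2 * (t ^ 3 / ?u t))"
  have "downcrossing (pi / 2) ?f2"
  proof (rule downcrossing_if_decreasing_quotient[where r = ?r and w = ?u])
    fix s t :: real assume st: "0 < s" "s < t" "t \<le> pi / 2"
    have "(sin s)\<^sup>2 \<le> (sin t)\<^sup>2"
      using st sin_mono_quadrant[of s t] sin_pos_quadrant[of s] by (intro power_mono) auto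
    then have "2 * (sin s)\<^sup>2 * (s ^ 3 / ?u s) \<le> 2 * (sin t)\<^sup>2 * (t ^ 3 / ?u t)"
      using st sin_minus_x_cos_pos[of s] less_imp_le[OF cube_over_sin_minus_x_cos_strict_mono[OF st]]
      by (intro mult_mono) auto
    then have "q * ((6 * s * sin s + 2 * s\<^sup>2 * cos s) + 2 * (sin s)\<^sup>2 * (s ^ 3 / ?u s))
        < q * ((6 * t * sin t + 2 * t\<^sup>2 * cos t) + 2 * (sin t)\<^sup>2 * (t ^ 3 / ?u t))"
      using x_sin_plus_sq_cos_strict_mono[OF st] q by (intro mult_strict_left_mono[OF add_less_le_mono])
    then show "?r t < ?r s" by linarith
  next
    fix t :: real assume t: "0 < t" "t \<le> pi / 2"
    then show u: "0 < ?u t" by (rule sin_minus_x_cos_pos)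
    have "?u t * (t ^ 3 / ?u t) = t ^ 3" using u by simp
    then show "?f2 t = ?u t * ?r t" by algebra
  qed
  then have "downcrossing (pi / 2) ?f1"
    by (rule downcrossing_antiderivative[rotated 2])
       (auto intro!: derivative_eq_intros simp: algebra_simps power2_eq_square power3_eq_cube)
  then have "downcrossing (pi / 2) ?f"
    by (rule downcrossing_antiderivative[rotated 2])
       (auto intro!: derivative_eq_intros simp: algebra_simps power2_eq_square)
  moreover have "?f (pi / 2) = 0"
    by (simp add: q_def field_simps)
  ultimately have "0 < ?f x" using assms by (rule downcrossing_pos)
  then show ?thesis by (simp add: q_def)
qed

section \<open>The bounds for the cardinal sine\<close>

theorem mainTheorem3:
  shows "(\<forall>x::real. 0 < x \<and> x < pi / 2 \<longrightarrow> \<Phi>\<^sub>1 x < \<Psi>\<^sub>1 x) \<and>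
    (\<forall>x::real. 0 < x \<and> x < pi / 2 \<longrightarrow>
      (2 + cos x) / 3 - (2 / 3 - 2 / pi) * \<Psi>\<^sub>1 x < (2 + cos x) / 3 - (2 / 3 - 2 / pi) * \<Phi>\<^sub>1 x \<and>
      (2 + cos x) / 3 - (2 / 3 - 2 / pi) * \<Psi>\<^sub>2 x < (2 + cos x) / 3 - (2 / 3 - 2 / pi) * \<Phi>\<^sub>2 x \<and>
      (2 + cos x) / 3 - (2 / 3 - 2 / pi) * \<Phi>\<^sub>1 x < sin x / x \<and>
      sin x / x < (2 + cos x) / 3 - (2 / 3 - 2 / pi) * \<Psi>\<^sub>2 x)"
proof -
  have "\<Phi>\<^sub>1 x < \<Psi>\<^sub>1 x \<and>
      (2 + cos x) / 3 - (2 / 3 - 2 / pi) * \<Psi>\<^sub>1 x < (2 + cos x) / 3 - (2 / 3 - 2 / pi) * \<Phi>\<^sub>1 x \<and>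
      (2 + cos x) / 3 - (2 / 3 - 2 / pi) * \<Psi>\<^sub>2 x < (2 + cos x) / 3 - (2 / 3 - 2 / pi) * \<Phi>\<^sub>2 x \<and>
      (2 + cos x) / 3 - (2 / 3 - 2 / pi) * \<Phi>\<^sub>1 x < sin x / x \<and>
      sin x / x < (2 + cos x) / 3 - (2 / 3 - 2 / pi) * \<Psi>\<^sub>2 x"
    if x: "0 < x" "x < pi / 2" for x :: real
  proof (intro conjI)
    have m: "0 < pi / 2 - 1" using pi_approx by simp
    have c: "0 < 2 / 3 - 2 / pi" using pi_approx by (simp add: field_simps)
    have phi1: "\<Phi>\<^sub>1 x = (x - sin x) / (pi / 2 - 1)"
      by (simp only: Phi1_def power_int_minus1_right divide_inverse mult.commute)
    have phi2: "\<Phi>\<^sub>2 x = (\<Phi>\<^sub>1 x)\<^sup>2"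
      by (simp add: phi1 Phi2_def power_int_minus power_divide)
        (simp only: divide_inverse mult.commute)
    have psi2: "\<Psi>\<^sub>2 x = (\<Psi>\<^sub>1 x)\<^sup>2"
      by (simp add: Psi1_def Psi2_def)
    show less: "\<Phi>\<^sub>1 x < \<Psi>\<^sub>1 x"
      using x_minus_sin_less[OF x] m by (simp add: phi1 Psi1_def pos_divide_less_eq mult.commute)
    have "0 \<le> \<Phi>\<^sub>1 x"
      using sin_x_le_x[of x] x m by (simp add: phi1)
    then have "\<Phi>\<^sub>2 x < \<Psi>\<^sub>2 x"
      unfolding phi2 psi2 using less by (intro power_strict_mono) auto
    then have "(2 / 3 - 2 / pi) * \<Phi>\<^sub>2 x < (2 / 3 - 2 / pi) * \<Psi>\<^sub>2 x"
      using c by (rule mult_strict_left_mono)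
    then show "(2 + cos x) / 3 - (2 / 3 - 2 / pi) * \<Psi>\<^sub>2 x < (2 + cos x) / 3 - (2 / 3 - 2 / pi) * \<Phi>\<^sub>2 x"
      by linarith
    have "(2 / 3 - 2 / pi) * \<Phi>\<^sub>1 x < (2 / 3 - 2 / pi) * \<Psi>\<^sub>1 x"
      using less c by (rule mult_strict_left_mono)
    then show "(2 + cos x) / 3 - (2 / 3 - 2 / pi) * \<Psi>\<^sub>1 x < (2 + cos x) / 3 - (2 / 3 - 2 / pi) * \<Phi>\<^sub>1 x"
      by linarith
    have defect: "x * (2 + cos x) - 3 * sin x = 3 * x * ((2 + cos x) / 3 - sin x / x)"
      using x by (simp add: field_simps)
    have factor: "2 - 6 / pi = 3 * (2 / 3 - 2 / pi)" by simp
    have "(2 - 6 / pi) / (pi / 2 - 1) * (x * (x - sin x)) = 3 * x * ((2 / 3 - 2 / pi) * \<Phi>\<^sub>1 x)"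
      unfolding phi1 factor by simp
    with cusa_defect_upper[OF x] x have "(2 + cos x) / 3 - sin x / x < (2 / 3 - 2 / pi) * \<Phi>\<^sub>1 x"
      by (simp only: defect mult_less_cancel_left_pos zero_less_mult_iff zero_less_numeral simp_thms)
    then show "(2 + cos x) / 3 - (2 / 3 - 2 / pi) * \<Phi>\<^sub>1 x < sin x / x"
      by linarith
    have "(2 - 6 / pi) * (x * (sin x - x * cos x)\<^sup>2) = 3 * x * ((2 / 3 - 2 / pi) * \<Psi>\<^sub>2 x)"
      unfolding Psi2_def factor by simp
    with cusa_defect_lower[OF x] x have "(2 / 3 - 2 / pi) * \<Psi>\<^sub>2 x < (2 + cos x) / 3 - sin x / x"
      by (simp only: defect mult_less_cancel_left_pos zero_less_mult_iff zero_less_numeral simp_thms)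
    then show "sin x / x < (2 + cos x) / 3 - (2 / 3 - 2 / pi) * \<Psi>\<^sub>2 x"
      by linarith
  qed
  then show ?thesis by blast
qed

end
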